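(* Let $\Omega$ be a domain in $\mathbb R^n$, let $l=(l_1,\dots,l_n)\in\mathbb N^n$ be a vector with positive integer components, and let $n\ge 2N+1$, where $N\ge 1$. Then $l$-quasielliptic systems $\{P_j(x,D)\}_{j=1}^N$ of $N$ differential operators of the form $P_j(x,D)=\sum_{|\alpha:l|\le 1}a_{j\alpha}(x)D^\alpha$, $x\in\Omega$, with measurable coefficients $a_{j\alpha}$, exist if and only if the number of odd integers among $l_1,\dots,l_n$ does not exceed $2N-1$.
   Context: Notation: $D_k=-i\,\partial/\partial x_k$, $D^\alpha=D_1^{\alpha_1}\cdots D_n^{\alpha_n}$ for $\alpha\in\mathbb Z_+^n$, $|\alpha:l|=\alpha_1/l_1+\dots+\alpha_n/l_n$. Coefficients are complex-valued. The principal $l$-quasihomogeneous symbol of $P_j(x,D)=\sum_{|\alpha:l|\le1}a_{j\alpha}(x)D^\alpha$ is $P_j^l(x,\xi)=\sum_{|\alpha:l|=1}a_{j\alpha}(x)\xi^\alpha$. The system $\{P_j(x,D)\}_{1}^N$ is called $l$-quasielliptic if $(P_1^l(x,\xi),\dots,P_N^l(x,\xi))\ne 0$ for all $(x,\xi)\in\Omega\times(\mathbb R^n\setminus\{0\})$. *)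

theory Defs
  imports "HOL-Analysis.Analysis"
begin

definition domain :: "'a::topological_space set \<Rightarrow> bool" where
  "domain \<Omega> \<longleftrightarrow> open \<Omega> \<and> connected \<Omega> \<and> \<Omega> \<noteq> {}"

text \<open>The weighted length \<open>|\<alpha>:l|\<close>.\<close>

definition wlen :: "nat ^ 'n \<Rightarrow> nat ^ 'n \<Rightarrow> real" where
  "wlen \<alpha> l = (\<Sum>k\<in>UNIV. real (\<alpha> $ k) / real (l $ k))"

definition D :: "'n \<Rightarrow> (real ^ 'n \<Rightarrow> complex) \<Rightarrow> real ^ 'n \<Rightarrow> complex" where
  "D k u x = - \<i> * vector_derivative (\<lambda>t. u (x + t *\<^sub>R axis k 1)) (at 0)"

text \<open>The index type carries no order, so the numbering of the coordinates is a fixed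
  arbitrary one; on smooth functions, the only ones to which operators are applied below,
  the iterated derivative does not depend on it.\<close>

definition coords :: "'n::finite list" where
  "coords = (SOME ks. distinct ks \<and> set ks = UNIV)"

definition D_multi :: "nat ^ 'n \<Rightarrow> (real ^ 'n \<Rightarrow> complex) \<Rightarrow> real ^ 'n \<Rightarrow> complex" where
  "D_multi \<alpha> u = foldr (\<lambda>k. D k ^^ (\<alpha> $ k)) coords u"

text \<open>Differentiability of all iterated partial derivatives makes them all continuous, so this
  is the class of infinitely differentiable functions on an open set.\<close>

definition smooth_on :: "(real ^ 'n) set \<Rightarrow> (real ^ 'n \<Rightarrow> complex) \<Rightarrow> bool" where
  "smooth_on \<Omega> u \<longleftrightarrow> (\<forall>ks. foldr D ks u differentiable_on \<Omega>)"

text \<open>\<open>P\<close> is the operator with coefficients \<open>a\<close>; the latter matter only on \<open>\<Omega>\<close> and for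
  multi-indices of weighted length at most 1.\<close>

definition diff_operator_on ::
  "(real ^ 'n) set \<Rightarrow> nat ^ 'n \<Rightarrow> (nat ^ 'n \<Rightarrow> real ^ 'n \<Rightarrow> complex) \<Rightarrow>
   ((real ^ 'n \<Rightarrow> complex) \<Rightarrow> real ^ 'n \<Rightarrow> complex) \<Rightarrow> bool" where
  "diff_operator_on \<Omega> l a P \<longleftrightarrow>
     (\<forall>u. smooth_on \<Omega> u \<longrightarrow>
       (\<forall>x\<in>\<Omega>. P u x = (\<Sum>\<alpha> | wlen \<alpha> l \<le> 1. a \<alpha> x * D_multi \<alpha> u x)))"

definition principal_symbol ::
  "nat ^ 'n \<Rightarrow> (nat ^ 'n \<Rightarrow> real ^ 'n \<Rightarrow> complex) \<Rightarrow> real ^ 'n \<Rightarrow> real ^ 'n \<Rightarrow> complex" where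
  "principal_symbol l a x \<xi> =
     (\<Sum>\<alpha> | wlen \<alpha> l = 1. a \<alpha> x * (\<Prod>k\<in>UNIV. complex_of_real (\<xi> $ k) ^ (\<alpha> $ k)))"

definition quasielliptic ::
  "(real ^ 'n) set \<Rightarrow> nat ^ 'n \<Rightarrow> nat \<Rightarrow>
   (nat \<Rightarrow> nat ^ 'n \<Rightarrow> real ^ 'n \<Rightarrow> complex) \<Rightarrow> bool" where
  "quasielliptic \<Omega> l N a \<longleftrightarrow>
     (\<forall>x\<in>\<Omega>. \<forall>\<xi>. \<xi> \<noteq> 0 \<longrightarrow> (\<exists>j\<in>{1..N}. principal_symbol l (a j) x \<xi> \<noteq> 0))"

text \<open>The index sets of the two sums are finite, so neither sum is 0 by convention.\<close>

lemma finite_wlen_le: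
  assumes "\<And>k. 0 < l $ k"
  shows "finite {\<alpha>. wlen \<alpha> l \<le> 1}"
proof -
  have "{\<alpha>. wlen \<alpha> l \<le> 1} \<subseteq> vec_lambda ` (PiE UNIV (\<lambda>k. {..l $ k}))"
  proof
    fix \<alpha> assume "\<alpha> \<in> {\<alpha>. wlen \<alpha> l \<le> 1}"
    then have le: "(\<Sum>k\<in>UNIV. real (\<alpha> $ k) / real (l $ k)) \<le> 1"
      by (simp add: wlen_def)
    have "\<alpha> $ k \<le> l $ k" for k
    proof -
      have "real (\<alpha> $ k) / real (l $ k) \<le> (\<Sum>k\<in>UNIV. real (\<alpha> $ k) / real (l $ k))"
        by (rule member_le_sum) auto
      with le have "real (\<alpha> $ k) / real (l $ k) \<le> 1" by linarith
      with assms[of k] show ?thesis by (simp add: divide_le_eq)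
    qed
    then have "vec_nth \<alpha> \<in> PiE UNIV (\<lambda>k. {..l $ k})" by auto
    moreover have "\<alpha> = vec_lambda (vec_nth \<alpha>)" by simp
    ultimately show "\<alpha> \<in> vec_lambda ` (PiE UNIV (\<lambda>k. {..l $ k}))" by blast
  qed
  moreover have "finite (PiE UNIV (\<lambda>k. {..l $ k}))"
    by (rule finite_PiE) auto
  ultimately show ?thesis by (meson finite_imageI finite_subset)
qed

lemma finite_wlen_eq:
  assumes "\<And>k. 0 < l $ k"
  shows "finite {\<alpha>. wlen \<alpha> l = 1}"
  by (rule finite_subset[OF _ finite_wlen_le[OF assms]]) auto

end

theory Submission
  imports "HOL-Homology.Invariance_of_Domain" Defs
begin

text \<open>Necessity: at a fixed point \<open>x\<close>, keep \<open>2 * N\<close> variables of odd weight and one further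
  variable, of weight \<open>2 ^ r * m\<close> with \<open>m\<close> odd, and set the others to zero. Clearing denominators in
  \<open>|\<alpha>:l| = 1\<close> shows that \<open>2 ^ r\<close> divides the exponent of the further variable and that, after this
  variable is replaced by its \<open>2 ^ r\<close>-th root, every monomial has odd total degree. The real and
  imaginary parts of the \<open>N\<close> symbols then form an odd polynomial map from dimension \<open>2 * N + 1\<close> to
  dimension \<open>2 * N\<close>, which has a nontrivial zero by the Borsuk--Ulam theorem.

  Sufficiency: the sum of the even powers \<open>\<xi>\<^sub>k ^ l\<^sub>k\<close> and the individual odd powers are at most
  \<open>2 * N\<close> real forms without a common nontrivial zero; they serve as the real and imaginary parts of
  \<open>N\<close> symbols with constant coefficients.\<close>

section \<open>Values missed by differentiable images of subspheres\<close>

text \<open>\<open>S\<close> lies in the unit sphere of the coordinate subspace of \<open>K\<close>,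
  so the \<open>K\<close>-coordinates of its image fill only a null set. To work in full dimension,
  \<open>S\<close> is replaced by the cylinder \<open>T\<close> over it and \<open>f\<close> by
  \<open>g\<close>, which leaves the coordinates outside \<open>K\<close> alone; any value that
  \<open>g\<close> misses on \<open>T\<close> serves as \<open>c\<close>.\<close>

lemma ex_value_avoided_on_subsphere:
  fixes f :: "real ^ 'n \<Rightarrow> real ^ 'n"
  assumes f: "f differentiable_on S"
    and S: "\<And>v. v \<in> S \<Longrightarrow> norm v = 1"
    and supp: "\<And>v k. v \<in> S \<Longrightarrow> k \<notin> K \<Longrightarrow> v $ k = 0"
  obtains c where "\<And>v. v \<in> S \<Longrightarrow> \<exists>k\<in>K. f v $ k \<noteq> c $ k"
proof -
  define \<pi> :: "real ^ 'n \<Rightarrow> real ^ 'n" where "\<pi> v = (\<chi> k. if k \<in> K then v $ k else 0)" for v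
  have lin: "linear \<pi>"
    by (rule linearI) (auto simp: \<pi>_def vec_eq_iff)
  define T where "T = {w. \<pi> w \<in> S}"
  define g where "g w = \<pi> (f (\<pi> w)) + (w - \<pi> w)" for w
  have "negligible {w. norm (\<pi> w) = 1}"
  \<comment> \<open>A ray from the origin meets the cylinder over the unit sphere at most
    once.\<close>
  proof (rule starlike_negligible[where a = 0])
    show "closed {w. norm (\<pi> w) = 1}"
      using lin by (intro closed_Collect_eq continuous_intros linear_continuous_on)
        (auto simp: linear_conv_bounded_linear)
  next
    fix c :: real and x
    assume "0 + c *\<^sub>R x \<in> {w. norm (\<pi> w) = 1}" "0 \<le> c" "0 + x \<in> {w. norm (\<pi> w) = 1}"
    then show "c = 1"
      using linear_cmul[OF lin, of c x] by simp
  qed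
  then have negT: "negligible T"
    by (rule negligible_subset) (use S in \<open>auto simp: T_def\<close>)
  have d\<pi>: "\<pi> differentiable_on U" for U
    using lin by (simp add: linear_imp_differentiable_on)
  have "g differentiable_on T"
    unfolding g_def
  proof (intro differentiable_on_add differentiable_on_diff d\<pi> differentiable_on_ident)
    have "f differentiable_on \<pi> ` T"
      by (rule differentiable_on_subset[OF f]) (auto simp: T_def)
    then have "(\<lambda>w. f (\<pi> w)) differentiable_on T"
      by (rule differentiable_on_compose[OF d\<pi>, where f = f])
    then show "(\<lambda>w. \<pi> (f (\<pi> w))) differentiable_on T"
      using d\<pi> by (rule differentiable_on_compose[where f = \<pi>])
  qed
  then have "negligible (g ` T)"
    using negT by (intro negligible_differentiable_image_negligible) auto
  then have "g ` T \<noteq> UNIV"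
    by auto
  then obtain c where c: "c \<notin> g ` T" by auto
  show ?thesis
  proof (rule that[of c], rule ccontr)
    fix v assume v: "v \<in> S" and "\<not> (\<exists>k\<in>K. f v $ k \<noteq> c $ k)"
    then have eq: "\<pi> (f v) = \<pi> c"
      by (auto simp: \<pi>_def vec_eq_iff)
    \<comment> \<open>This point of the cylinder over \<open>v\<close> has the coordinates of
      \<open>c\<close> outside \<open>K\<close>; as \<open>f v\<close> agrees with \<open>c\<close>
      on \<open>K\<close>, it is mapped to \<open>c\<close> by \<open>g\<close>.\<close>
    define w where "w = v + (c - \<pi> c)"
    have "\<pi> w = v"
      using supp[OF v] by (auto simp: \<pi>_def w_def vec_eq_iff)
    then have "w \<in> T" "g w = c"
      using v eq by (simp_all add: T_def g_def w_def)
    with c show False by blast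
  qed
qed

section \<open>Continuous maps into spheres and their coordinates\<close>

text \<open>Radial projection of \<open>(h 0 x, ..., h m x)\<close> to the unit sphere. The
  components beyond \<open>m\<close> are 0 because the points of \<open>nsphere m\<close> are
  sequences supported on \<open>{..m}\<close>.\<close>

definition sphere_normalise :: "nat \<Rightarrow> (nat \<Rightarrow> 'a \<Rightarrow> real) \<Rightarrow> 'a \<Rightarrow> nat \<Rightarrow> real" where
  "sphere_normalise m h x i = (if i \<le> m then h i x / sqrt (\<Sum>j\<le>m. (h j x)\<^sup>2) else 0)"

lemma continuous_map_sphere_normalise:
  assumes cont: "\<And>i. i \<le> m \<Longrightarrow> continuous_map X euclideanreal (h i)"
    and nz: "\<And>x. x \<in> topspace X \<Longrightarrow> \<exists>i\<le>m. h i x \<noteq> 0"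
  shows "continuous_map X (nsphere m) (sphere_normalise m h)"
proof -
  have pos: "(\<Sum>j\<le>m. (h j x)\<^sup>2) > 0" if x: "x \<in> topspace X" for x
  proof -
    obtain i where "i \<le> m" "h i x \<noteq> 0" using nz[OF x] by blast
    then show ?thesis by (intro sum_pos2[where i = i]) auto
  qed
  have "continuous_map X euclideanreal (\<lambda>x. sphere_normalise m h x i)" for i
  proof (cases "i \<le> m")
    case True
    then show ?thesis
      unfolding sphere_normalise_def using pos
      by (auto intro!: continuous_intros cont simp: less_le[of 0] dest!: pos)
  qed (simp add: sphere_normalise_def)
  moreover have "(\<Sum>i\<le>m. (sphere_normalise m h x i)\<^sup>2) = 1" if "x \<in> topspace X" for x
  proof -
    have "(\<Sum>i\<le>m. (sphere_normalise m h x i)\<^sup>2) = (\<Sum>i\<le>m. (h i x)\<^sup>2 / (\<Sum>j\<le>m. (h j x)\<^sup>2))"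
      using pos[OF that] by (intro sum.cong) (auto simp: sphere_normalise_def power_divide)
    also have "\<dots> = 1"
      using pos[OF that] by (simp flip: sum_divide_distrib)
    finally show ?thesis .
  qed
  moreover have "sphere_normalise m h x i = 0" if "i > m" for x i
    using that by (simp add: sphere_normalise_def)
  ultimately show ?thesis
    by (auto simp: nsphere continuous_map_in_subtopology continuous_map_componentwise_UNIV)
qed

text \<open>Degrees are taken on spheres of sequences, while differentiability and negligible sets
  belong to \<open>real ^ 'n\<close>; a numbering \<open>idx\<close> of the coordinates links the
  two.\<close>

definition vec_of_seq :: "('n \<Rightarrow> nat) \<Rightarrow> (nat \<Rightarrow> real) \<Rightarrow> real ^ 'n" where
  "vec_of_seq idx x = (\<chi> k. x (idx k))"

lemma norm_vec_of_seq:
  assumes idx: "bij_betw idx (UNIV :: 'n::finite set) {..<CARD('n)}"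
    and m: "m < CARD('n)" and x: "x \<in> topspace (nsphere m)"
  shows "norm (vec_of_seq idx x) = 1"
proof -
  have "(\<Sum>k\<in>UNIV. (x (idx k))\<^sup>2) = (\<Sum>i<CARD('n). (x i)\<^sup>2)"
    by (rule sum.reindex_bij_betw[OF idx])
  also have "\<dots> = (\<Sum>i\<le>m. (x i)\<^sup>2)"
    using m x by (intro sum.mono_neutral_right) (auto simp: nsphere not_le)
  also have "\<dots> = 1"
    using x by (simp add: nsphere)
  finally show ?thesis
    by (simp add: norm_vec_def L2_set_def vec_of_seq_def)
qed

lemma continuous_map_vec_of_seq:
  "continuous_map (nsphere m) euclidean (vec_of_seq idx :: _ \<Rightarrow> real ^ 'n::finite)"
proof -
  have "continuous_map (nsphere m) euclidean (\<lambda>x. \<Sum>k\<in>UNIV. x (idx k) *\<^sub>R (axis k 1 :: real ^ 'n))"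
  proof (rule continuous_map_sum)
    fix k :: 'n
    have "continuous_map euclideanreal euclidean (\<lambda>r. r *\<^sub>R (axis k 1 :: real ^ 'n))"
      by (simp, intro continuous_intros)
    from continuous_map_compose[OF continuous_map_nsphere_projection this]
    show "continuous_map (nsphere m) euclidean (\<lambda>x. x (idx k) *\<^sub>R (axis k 1 :: real ^ 'n))"
      by (simp add: o_def)
  qed auto
  also have "(\<lambda>x. \<Sum>k\<in>UNIV. x (idx k) *\<^sub>R (axis k 1 :: real ^ 'n)) = vec_of_seq idx"
    by (auto simp: fun_eq_iff vec_of_seq_def vec_eq_iff axis_def if_distrib cong: if_cong)
  finally show ?thesis .
qed

section \<open>Odd degree of odd maps and the Borsuk--Ulam theorem\<close>

text \<open>The sphere has two points, so an odd self-map is the identity or the antipodal map, of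
  degree 1 or -1.\<close>

lemma odd_Brouwer_degree2_nsphere_0:
  assumes cont: "continuous_map (nsphere 0) (nsphere 0) f"
    and odd: "\<And>x. x \<in> topspace (nsphere 0) \<Longrightarrow> f (\<lambda>i. - x i) = (\<lambda>i. - f x i)"
  shows "odd (Brouwer_degree2 0 f)"
proof -
  define u :: "nat \<Rightarrow> real" where "u = (\<lambda>i. if i = 0 then 1 else 0)"
  have two: "x = u \<or> x = (\<lambda>i. - u i)" if "x \<in> topspace (nsphere 0)" for x
    using that by (auto simp: nsphere u_def power2_eq_1_iff fun_eq_iff)
  have u: "u \<in> topspace (nsphere 0)"
    unfolding u_def by (rule in_topspace_nsphere)
  then have "f u \<in> topspace (nsphere 0)"
    using cont continuous_map_image_subset_topspace by blast
  from two[OF this] consider "f u = u" | "f u = (\<lambda>i. - u i)" by blast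
  then show ?thesis
  proof cases
    case 1
    then have "f x = id x" if "x \<in> topspace (nsphere 0)" for x
      using two[OF that] odd[OF u] by auto
    then have "Brouwer_degree2 0 f = 1"
      using Brouwer_degree2_eq[of 0 f id] by simp
    then show ?thesis by simp
  next
    case 2
    \<comment> \<open>On sequences supported at 0 the antipodal map agrees with the reflection in
      the coordinate 0, whose degree is -1.\<close>
    have "(\<lambda>i. if i = 0 then - u i else u i) = (\<lambda>i. - u i)"
      and "(\<lambda>i. if i = 0 then - (- u i) else - u i) = u"
      by (auto simp: u_def)
    then have "f x = (\<lambda>i. if i = 0 then - x i else x i)" if "x \<in> topspace (nsphere 0)" for x
      using two[OF that] odd[OF u] 2 by auto
    then have "Brouwer_degree2 0 f = -1"
      using Brouwer_degree2_eq[of 0 f "\<lambda>x i. if i = 0 then - x i else x i"]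
      by (simp add: Brouwer_degree2_reflection)
    then show ?thesis by simp
  qed
qed

lemma sphere_normalise_odd:
  assumes "\<And>i. i \<le> m \<Longrightarrow> h i y = - h i x"
  shows "sphere_normalise m h y = (\<lambda>i. - sphere_normalise m h x i)"
  using assms by (auto simp: sphere_normalise_def fun_eq_iff)

lemma sphere_normalise_cong:
  assumes "\<And>i. i \<le> m \<Longrightarrow> h i x = h' i y"
  shows "sphere_normalise m h x = sphere_normalise m h' y"
  using assms by (auto simp: sphere_normalise_def fun_eq_iff)

text \<open>Recognises values on the equator; its points are the same sequences in both
  spheres.\<close>

lemma sphere_normalise_Suc:
  assumes "h (Suc m) x = 0"
  shows "sphere_normalise (Suc m) h x = sphere_normalise m h x"
  using assms by (auto simp: sphere_normalise_def fun_eq_iff le_Suc_eq)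

lemma topspace_nsphere_subset_Suc: "topspace (nsphere m) \<subseteq> topspace (nsphere (Suc m))"
  by (auto simp: nsphere)

text \<open>Borsuk's theorem on the odd degree of odd maps of spheres, by induction on the dimension
  through \<open>Borsuk_odd_mapping_degree_step\<close>: that theorem needs a map preserving the equator, and
  an odd deformation produces one as soon as the image of the equator avoids a direction. Such a
  direction exists because the differentiable image of the equator in the chart \<open>p i / p (Suc m)\<close>
  is negligible.\<close>

lemma odd_Brouwer_degree2_sphere_normalise:
  fixes p :: "nat \<Rightarrow> real ^ 'n \<Rightarrow> real"
  assumes idx: "bij_betw idx (UNIV :: 'n set) {..<CARD('n)}"
    and "m < CARD('n)"
    and "\<And>i. i \<le> m \<Longrightarrow> p i differentiable_on UNIV"
    and "\<And>i v. i \<le> m \<Longrightarrow> p i (- v) = - p i v"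
    and "\<And>x. x \<in> topspace (nsphere m) \<Longrightarrow> \<exists>i\<le>m. p i (vec_of_seq idx x) \<noteq> 0"
  shows "odd (Brouwer_degree2 m (sphere_normalise m (\<lambda>i x. p i (vec_of_seq idx x))))"
  using assms(2-5)
proof (induction m arbitrary: p)
  case (0 p)
  have cont: "continuous_map (nsphere 0) euclideanreal (\<lambda>x. p 0 (vec_of_seq idx x))"
    using continuous_map_compose[OF continuous_map_vec_of_seq[of 0 idx], of euclideanreal "p 0"]
      differentiable_imp_continuous_on[OF "0.prems"(2)] by (simp add: o_def)
  show ?case
  proof (rule odd_Brouwer_degree2_nsphere_0)
    show "continuous_map (nsphere 0) (nsphere 0) (sphere_normalise 0 (\<lambda>i x. p i (vec_of_seq idx x)))"
      using 0 cont by (intro continuous_map_sphere_normalise) auto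
  next
    fix x
    show "sphere_normalise 0 (\<lambda>i x. p i (vec_of_seq idx x)) (\<lambda>i. - x i) =
      (\<lambda>i. - sphere_normalise 0 (\<lambda>i x. p i (vec_of_seq idx x)) x i)"
      using 0(3)[of 0 "vec_of_seq idx x"]
      by (intro sphere_normalise_odd) (auto simp: vec_of_seq_def uminus_vec_def)
  qed
next
  case (Suc m p)
  let ?v = "vec_of_seq idx :: _ \<Rightarrow> real ^ 'n"
  let ?X = "topspace (nsphere m)" and ?Y = "topspace (nsphere (Suc m))"
  have neg: "?v (\<lambda>i. - x i) = - ?v x" for x
    by (simp add: vec_of_seq_def vec_eq_iff)
  have cont: "continuous_map (nsphere (Suc m)) euclideanreal (\<lambda>x. p i (?v x))" if "i \<le> Suc m" for i
    using continuous_map_compose[OF continuous_map_vec_of_seq[of "Suc m" idx], of euclideanreal "p i"]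
      differentiable_imp_continuous_on[OF Suc.prems(2)[OF that]] by (simp add: o_def)
  \<comment> \<open>The points of the equator at which the chart \<open>p i / p (Suc m)\<close> is
    defined.\<close>
  define V where "V = {v. norm v = 1 \<and> (\<forall>k. Suc m \<le> idx k \<longrightarrow> v $ k = 0) \<and> p (Suc m) v \<noteq> 0}"
  have diff: "(\<lambda>v. \<chi> k. if idx k \<le> m then p (idx k) v / p (Suc m) v else 0) differentiable_on V"
    unfolding differentiable_on_def
  proof
    fix v assume "v \<in> V"
    have "(\<lambda>v. if idx k \<le> m then p (idx k) v / p (Suc m) v else 0) differentiable at v within V" for k
      using Suc.prems(2) \<open>v \<in> V\<close>
      by (cases "idx k \<le> m")
        (auto intro!: differentiable_divide simp: V_def differentiable_on_def intro: differentiable_at_withinI)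
    then show "(\<lambda>v. \<chi> k. if idx k \<le> m then p (idx k) v / p (Suc m) v else 0) differentiable at v within V"
      by (subst differentiable_componentwise_within) (auto simp: Basis_vec_def inner_axis)
  qed
  obtain c' :: "real ^ 'n" where c': "\<And>v. v \<in> V \<Longrightarrow>
      \<exists>k\<in>{k. idx k \<le> m}. (\<chi> k. if idx k \<le> m then p (idx k) v / p (Suc m) v else 0) $ k \<noteq> c' $ k"
    by (rule ex_value_avoided_on_subsphere[OF diff, of "{k. idx k \<le> m}"]) (auto simp: V_def not_le Suc_le_eq)
  define c where "c i = c' $ inv_into UNIV idx i" for i
  have "inj idx" using idx by (simp add: bij_betw_def)
  then have c: "\<exists>i\<le>m. p i v \<noteq> c i * p (Suc m) v" if "v \<in> V" for v
    using c'[OF that] that by (force simp: c_def V_def field_simps)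
  \<comment> \<open>Projection of \<open>p\<close> to its first \<open>Suc m\<close> components
    along \<open>(c 0, ..., c m, 1)\<close>. A zero of \<open>q\<close> on the equator would put
    \<open>p\<close> on this line: the choice of \<open>c\<close> excludes this if
    \<open>p (Suc m)\<close> is nonzero there, and otherwise all components of \<open>p\<close>
    would vanish.\<close>
  define q where "q i v = p i v - c i * p (Suc m) v" for i v
  have q_nz: "\<exists>i\<le>m. q i (?v x) \<noteq> 0" if x: "x \<in> ?X" for x
  proof (cases "p (Suc m) (?v x) = 0")
    case True
    moreover obtain i where "i \<le> Suc m" "p i (?v x) \<noteq> 0"
      using Suc.prems(4) x topspace_nsphere_subset_Suc by blast
    ultimately show ?thesis
      by (auto simp: q_def le_Suc_eq)
  next
    case False
    then have "?v x \<in> V"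
      using x norm_vec_of_seq[OF idx, of m x] Suc.prems(1) by (auto simp: V_def vec_of_seq_def nsphere)
    then show ?thesis
      using c by (force simp: q_def)
  qed
  have IH: "odd (Brouwer_degree2 m (sphere_normalise m (\<lambda>i x. q i (?v x))))"
  proof (rule Suc.IH)
    show "q i differentiable_on UNIV" if "i \<le> m" for i
      unfolding q_def using Suc.prems(2) that by (auto intro!: derivative_intros differentiable_on_mult)
    show "q i (- v) = - q i v" if "i \<le> m" for i v
      using that by (simp add: q_def Suc.prems(3))
  qed (use Suc.prems(1) q_nz in auto)
  \<comment> \<open>At \<open>t = 0\<close> this is \<open>p\<close>; at \<open>t = 1\<close>, on
    the equator, the last component vanishes and the others are \<open>q\<close>. The factor of the
    last component is zero only at \<open>t = 1\<close> on the equator, so elsewhere a zero of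
    \<open>H\<close> would be one of \<open>p\<close>. Since that factor is even in
    \<open>x\<close>, every stage is odd.\<close>
  define H where "H i = (\<lambda>(t :: real, x). if i \<le> m then p i (?v x) - t * c i * p (Suc m) (?v x)
    else (1 - t * (1 - (x (Suc m))\<^sup>2)) * p (Suc m) (?v x))" for i
  define F where "F = sphere_normalise (Suc m) H"
  have contF: "continuous_map (prod_topology (top_of_set {0..1::real}) (nsphere (Suc m))) (nsphere (Suc m)) F"
    unfolding F_def
  proof (rule continuous_map_sphere_normalise)
    fix i assume i: "i \<le> Suc m"
    show "continuous_map (prod_topology (top_of_set {0..1::real}) (nsphere (Suc m))) euclideanreal (H i)"
      unfolding H_def case_prod_unfold using i
      by (cases "i \<le> m")
       (auto intro!: continuous_intros continuous_map_compose[OF continuous_map_snd cont, unfolded o_def]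
         continuous_map_compose[OF continuous_map_snd continuous_map_nsphere_projection, unfolded o_def]
         continuous_map_into_fulltopology[OF continuous_map_fst])
  next
    fix z assume "z \<in> topspace (prod_topology (top_of_set {0..1::real}) (nsphere (Suc m)))"
    then obtain t x where z: "z = (t, x)" and t: "0 \<le> t" "t \<le> 1" and x: "x \<in> ?Y"
      by (cases z) auto
    show "\<exists>i\<le>Suc m. H i z \<noteq> 0"
    proof (cases "t = 1 \<and> x (Suc m) = 0")
      case True
      then have "x \<in> ?X"
        using topspace_nsphere_minus1[OF x] by simp
      from q_nz[OF this] obtain i where "i \<le> m" "q i (?v x) \<noteq> 0" by blast
      then show ?thesis
        using True by (intro exI[of _ i]) (auto simp: H_def z q_def)
    next
      case False
      have "(x (Suc m))\<^sup>2 \<le> (\<Sum>i\<le>Suc m. (x i)\<^sup>2)"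
        by (rule member_le_sum) auto
      then have le1: "(x (Suc m))\<^sup>2 \<le> 1"
        using x by (simp add: nsphere)
      have "1 - t * (1 - (x (Suc m))\<^sup>2) \<noteq> 0"
      proof (cases "t = 1")
        case True
        then show ?thesis using False by auto
      next
        case False
        have "t * (1 - (x (Suc m))\<^sup>2) \<le> t * 1"
          using t by (intro mult_left_mono) auto
        then show ?thesis using t False by linarith
      qed
      moreover obtain i where "i \<le> Suc m" "p i (?v x) \<noteq> 0"
        using Suc.prems(4) x by blast
      ultimately show ?thesis
        by (cases "p (Suc m) (?v x) = 0") (auto simp: H_def z le_Suc_eq intro: exI[of _ "Suc m"])
    qed
  qed
  let ?f = "sphere_normalise (Suc m) (\<lambda>i x. p i (?v x))" and ?g = "\<lambda>x. F (1, x)"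
  have hom: "homotopic_with (\<lambda>x. True) (nsphere (Suc m)) (nsphere (Suc m)) ?f ?g"
    unfolding homotopic_with_def
  proof (intro exI[of _ F] conjI allI ballI)
    show "F (0, x) = ?f x" for x
      unfolding F_def by (rule sphere_normalise_cong) (auto simp: H_def le_Suc_eq)
  qed (use contF in auto)
  have "Brouwer_degree2 (Suc m) ?f = Brouwer_degree2 (Suc m) ?g"
    by (rule Brouwer_degree2_homotopic[OF hom])
  moreover have gX: "?g x = sphere_normalise m (\<lambda>i x. q i (?v x)) x" if "x \<in> ?X" for x
  proof -
    have "?g x = sphere_normalise m H (1, x)"
      unfolding F_def by (rule sphere_normalise_Suc) (use that in \<open>auto simp: H_def nsphere\<close>)
    also have "\<dots> = sphere_normalise m (\<lambda>i x. q i (?v x)) x"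
      by (rule sphere_normalise_cong) (auto simp: H_def q_def)
    finally show ?thesis .
  qed
  have contq: "continuous_map (nsphere m) (nsphere m) (sphere_normalise m (\<lambda>i x. q i (?v x)))"
  proof (rule continuous_map_sphere_normalise)
    fix i assume "i \<le> m"
    have *: "continuous_map (nsphere m) euclideanreal (\<lambda>x. p j (?v x))" if "j \<le> Suc m" for j
      using continuous_map_from_subtopology[OF cont[OF that], of "{x. x (Suc m) = 0}"]
      by (simp add: subtopology_nsphere_equator)
    show "continuous_map (nsphere m) euclideanreal (\<lambda>x. q i (?v x))"
      unfolding q_def using \<open>i \<le> m\<close> by (intro continuous_intros *) auto
  qed (use q_nz in auto)
  \<comment> \<open>The degree of the odd map \<open>?g\<close> has the parity of the degree of its
    restriction to the equator, which is the normalised \<open>q\<close> of the induction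
    hypothesis.\<close>
  have "even (Brouwer_degree2 (Suc m) ?g - Brouwer_degree2 (Suc m - Suc 0) ?g)"
  proof (rule Borsuk_odd_mapping_degree_step)
    show "continuous_map (nsphere (Suc m)) (nsphere (Suc m)) ?g"
      using homotopic_with_imp_continuous_maps[OF hom] by blast
  next
    fix x :: "nat \<Rightarrow> real"
    have "H i (1, \<lambda>i. - x i) = - H i (1, x)" if "i \<le> Suc m" for i
      using that by (auto simp: H_def neg Suc.prems(3))
    then show "(?g \<circ> (\<lambda>x i. - x i)) x = ((\<lambda>x i. - x i) \<circ> ?g) x"
      by (auto simp: F_def intro!: sphere_normalise_odd)
  next
    show "?g \<in> topspace (nsphere (Suc m - Suc 0)) \<rightarrow> topspace (nsphere (Suc m - Suc 0))"
      using gX continuous_map_funspace[OF contq] by auto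
  qed
  moreover have "Brouwer_degree2 m ?g = Brouwer_degree2 m (sphere_normalise m (\<lambda>i x. q i (?v x)))"
    by (rule Brouwer_degree2_eq) (rule gX)
  ultimately show ?case
    using IH by auto
qed

text \<open>Without a common zero, normalising \<open>p\<close> gives an odd map of
  \<open>nsphere (Suc m)\<close> into its equator. Its restriction to the equator has odd degree,
  hence so has the map itself; but it is not surjective and so has degree 0. The zero found is
  supported on the first \<open>m + 2\<close> coordinates in the numbering \<open>idx\<close>, which
  allows all other variables to be set to zero.\<close>

theorem Borsuk_Ulam_differentiable:
  fixes p :: "nat \<Rightarrow> real ^ 'n \<Rightarrow> real"
  assumes idx: "bij_betw idx (UNIV :: 'n set) {..<CARD('n)}"
    and m: "Suc m < CARD('n)"
    and diff: "\<And>i. i \<le> m \<Longrightarrow> p i differentiable_on UNIV"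
    and odd: "\<And>i v. i \<le> m \<Longrightarrow> p i (- v) = - p i v"
  obtains x where "x \<in> topspace (nsphere (Suc m))" "\<And>i. i \<le> m \<Longrightarrow> p i (vec_of_seq idx x) = 0"
proof (rule ccontr)
  note BU = that
  assume no: "\<not> thesis"
  let ?v = "vec_of_seq idx :: _ \<Rightarrow> real ^ 'n"
  have nz: "\<exists>i\<le>m. p i (?v x) \<noteq> 0" if "x \<in> topspace (nsphere (Suc m))" for x
    using BU no that by blast
  let ?f = "sphere_normalise m (\<lambda>i x. p i (?v x))"
  have deg: "odd (Brouwer_degree2 m ?f)"
    using m diff odd nz[OF subsetD[OF topspace_nsphere_subset_Suc]]
    by (intro odd_Brouwer_degree2_sphere_normalise[OF idx]) auto
  have contf: "continuous_map (nsphere (Suc m)) (nsphere m) ?f"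
  proof (rule continuous_map_sphere_normalise)
    fix i assume i: "i \<le> m"
    show "continuous_map (nsphere (Suc m)) euclideanreal (\<lambda>x. p i (?v x))"
      using continuous_map_compose[OF continuous_map_vec_of_seq[of "Suc m" idx], of euclideanreal "p i"]
        differentiable_imp_continuous_on[OF diff[OF i]] by (simp add: o_def)
  qed (use nz in auto)
  have sub: "topspace (nsphere m) \<subseteq> topspace (nsphere (Suc m))"
    by (rule topspace_nsphere_subset_Suc)
  have contf': "continuous_map (nsphere (Suc m)) (nsphere (Suc m)) ?f"
    using contf by (metis continuous_map_in_subtopology subtopology_nsphere_equator)
  have "even (Brouwer_degree2 (Suc m) ?f - Brouwer_degree2 (Suc m - Suc 0) ?f)"
  proof (rule Borsuk_odd_mapping_degree_step[OF contf'])
    fix x :: "nat \<Rightarrow> real"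
    have "?v (\<lambda>i. - x i) = - ?v x"
      by (simp add: vec_of_seq_def vec_eq_iff)
    then show "(?f \<circ> (\<lambda>x i. - x i)) x = ((\<lambda>x i. - x i) \<circ> ?f) x"
      by (auto simp: odd intro!: sphere_normalise_odd)
  next
    show "?f \<in> topspace (nsphere (Suc m - Suc 0)) \<rightarrow> topspace (nsphere (Suc m - Suc 0))"
      using continuous_map_funspace[OF contf] sub by auto
  qed
  moreover have "Brouwer_degree2 (Suc m) ?f = 0"
  proof (rule Brouwer_degree2_nonsurjective[OF contf'])
    \<comment> \<open>The pole, which is off the equator.\<close>
    define u :: "nat \<Rightarrow> real" where "u i = (if i = Suc m then 1 else 0)" for i
    have "u \<in> topspace (nsphere (Suc m))"
      by (simp add: u_def nsphere if_distrib[of "\<lambda>x. x ^ 2"] cong: if_cong)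
    moreover have "u \<notin> ?f ` topspace (nsphere (Suc m))"
      by (auto simp: u_def sphere_normalise_def dest: fun_cong[where x = "Suc m"])
    ultimately show "?f ` topspace (nsphere (Suc m)) \<noteq> topspace (nsphere (Suc m))"
      by blast
  qed
  ultimately show False
    using deg by simp
qed

section \<open>Parity of the exponents of weighted forms\<close>

text \<open>\<open>L\<close> is the product of the \<open>l i\<close> and \<open>c i\<close> the
  cofactor \<open>L div l i\<close>; divisors of an odd number are odd.\<close>

lemma clear_odd_denominators:
  fixes l :: "'k \<Rightarrow> nat"
  assumes fin: "finite I" and odd: "\<And>i. i \<in> I \<Longrightarrow> odd (l i)"
  obtains L c where "odd L" "\<forall>i\<in>I. odd (c i)"
    "\<forall>a. (\<Sum>i\<in>I. real (a i) / real (l i)) * real L = real (\<Sum>i\<in>I. a i * c i)"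
proof -
  define L where "L = (\<Prod>i\<in>I. l i)"
  have oddL: "odd L"
    unfolding L_def using odd fin by (auto simp: even_prod_iff)
  have L: "L = l i * (L div l i)" if "i \<in> I" for i
    using that fin by (auto simp: L_def intro!: dvd_mult_div_cancel[symmetric] dvd_prodI)
  show ?thesis
  proof (rule that[OF oddL])
    show "\<forall>i\<in>I. odd (L div l i)"
      using L oddL by (metis even_mult_iff)
  next
    show "\<forall>a. (\<Sum>i\<in>I. real (a i) / real (l i)) * real L = real (\<Sum>i\<in>I. a i * (L div l i))"
    proof
      fix a :: "'k \<Rightarrow> nat"
      show "(\<Sum>i\<in>I. real (a i) / real (l i)) * real L = real (\<Sum>i\<in>I. a i * (L div l i))"
        unfolding of_nat_sum sum_distrib_right
      proof (rule sum.cong[OF refl])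
        fix i assume i: "i \<in> I"
        have "real L = real (l i) * real (L div l i)"
          using L[OF i] by (metis of_nat_mult)
        then show "real (a i) / real (l i) * real L = real (a i * (L div l i))"
          using odd[OF i] by (cases "l i = 0") (auto simp: field_simps)
      qed
    qed
  qed
qed

text \<open>After clearing denominators, a sum of the \<open>a i\<close> with odd coefficients
  equals an odd number; modulo 2 the coefficients disappear.\<close>

lemma odd_sum_of_weighted_sum_eq_1:
  fixes a l :: "'k \<Rightarrow> nat"
  assumes fin: "finite I" and odd: "\<And>i. i \<in> I \<Longrightarrow> odd (l i)"
    and one: "(\<Sum>i\<in>I. real (a i) / real (l i)) = 1"
  shows "odd (\<Sum>i\<in>I. a i)"
proof -
  obtain L c where L: "odd L" "\<forall>i\<in>I. odd (c i)"
    "\<forall>a. (\<Sum>i\<in>I. real (a i) / real (l i)) * real L = real (\<Sum>i\<in>I. a i * c i)"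
    by (rule clear_odd_denominators[OF fin odd])
  have "(\<Sum>i\<in>I. a i * c i) = L"
    using spec[OF L(3), of a] unfolding one mult_1 of_nat_eq_iff by (rule sym)
  moreover have "{i \<in> I. odd (a i * c i)} = {i \<in> I. odd (a i)}"
    using L(2) by auto
  ultimately show ?thesis
    using L(1) even_sum_iff[OF fin, of "\<lambda>i. a i * c i"] even_sum_iff[OF fin, of a] by simp
qed

text \<open>Clearing only the odd denominators and multiplying by \<open>l k0\<close> shows that
  \<open>l k0\<close> divides \<open>a k0 * L\<close> with \<open>L\<close> odd, so the power of 2
  in \<open>l k0\<close> must divide \<open>a k0\<close>.\<close>

lemma odd_sum_of_weighted_sum_eq_1_but_one:
  fixes a l :: "'k \<Rightarrow> nat"
  assumes fin: "finite J" and k0: "k0 \<in> J" and odd: "\<And>i. i \<in> J - {k0} \<Longrightarrow> odd (l i)"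
    and lk0: "l k0 = 2 ^ r * m" "odd m"
    and one: "(\<Sum>i\<in>J. real (a i) / real (l i)) = 1"
  shows "2 ^ r dvd a k0" and "odd (\<Sum>i\<in>J. if i = k0 then a i div 2 ^ r else a i)"
proof -
  let ?I = "J - {k0}"
  have "finite ?I" using fin by simp
  from this odd obtain L c where L: "odd L"
    "\<forall>a. (\<Sum>i\<in>?I. real (a i) / real (l i)) * real L = real (\<Sum>i\<in>?I. a i * c i)"
    by (rule clear_odd_denominators) blast
  note spec[OF L(2), of a, symmetric]
  also have "(\<Sum>i\<in>?I. real (a i) / real (l i)) = 1 - real (a k0) / real (l k0)"
    using one sum.remove[OF fin k0, of "\<lambda>i. real (a i) / real (l i)"] by simp
  finally have "real (l k0 * (\<Sum>i\<in>?I. a i * c i) + a k0 * L) = real (l k0 * L)"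
    using lk0 odd_pos[OF lk0(2)] by (auto simp: field_simps)
  then have "l k0 * (\<Sum>i\<in>?I. a i * c i) + a k0 * L = l k0 * L"
    by (simp only: of_nat_eq_iff)
  then have "l k0 dvd a k0 * L"
    by (metis dvd_add_right_iff dvd_triv_left)
  then have "2 ^ r dvd a k0 * L"
    using lk0 by (metis dvd_mult_left)
  moreover have "coprime (2 ^ r) L"
    using L(1) by simp
  ultimately show dvd: "2 ^ r dvd a k0"
    by (simp add: coprime_dvd_mult_left_iff)
  \<comment> \<open>Dividing the exponent and the weight at \<open>k0\<close> by
    \<open>2 ^ r\<close> preserves their quotient and leaves only odd weights.\<close>
  have "(\<Sum>i\<in>J. real (if i = k0 then a i div 2 ^ r else a i) / real (if i = k0 then m else l i)) =
      (\<Sum>i\<in>J. real (a i) / real (l i))"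
    using lk0 dvd by (intro sum.cong) (auto simp: real_of_nat_div)
  also note one
  finally have "(\<Sum>i\<in>J. real (if i = k0 then a i div 2 ^ r else a i) / real (if i = k0 then m else l i)) = 1" .
  then show "odd (\<Sum>i\<in>J. if i = k0 then a i div 2 ^ r else a i)"
    using odd lk0 by (intro odd_sum_of_weighted_sum_eq_1[OF fin]) auto
qed

section \<open>Common zeros of the symbols\<close>

lemma differentiable_on_monomial:
  "(\<lambda>v :: real ^ 'n. \<Prod>k\<in>K. complex_of_real (v $ k) ^ \<gamma> k) differentiable_on UNIV"
proof (induction K rule: infinite_finite_induct)
  case (insert k K)
  have "(\<lambda>v :: real ^ 'n. complex_of_real (v $ k)) differentiable_on UNIV"
    by (intro linear_imp_differentiable_on linearI) (auto simp: scaleR_conv_of_real[where 'a = complex])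
  then have "(\<lambda>v :: real ^ 'n. complex_of_real (v $ k) ^ \<gamma> k) differentiable_on UNIV"
    by (auto simp: differentiable_on_def intro: differentiable_power)
  with insert show ?case
    by (simp add: differentiable_on_mult)
qed auto

text \<open>Numbering the variables of \<open>J\<close> first identifies a sphere of sequences with
  the unit sphere in these variables.\<close>

lemma ex_bij_betw_initial_segment:
  fixes J :: "'n::finite set"
  obtains idx where "bij_betw idx (UNIV :: 'n set) {..<CARD('n)}" "idx ` J = {..<card J}"
proof -
  have le: "card J \<le> CARD('n)"
    by (simp add: card_mono)
  obtain f where f: "bij_betw f J {..<card J}"
    using finite_same_card_bij[of J "{..<card J}"] by auto
  have "card (- J) = card {card J..<CARD('n)}"
    by (simp add: Compl_eq_Diff_UNIV card_Diff_subset)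
  then obtain g where g: "bij_betw g (- J) {card J..<CARD('n)}"
    using finite_same_card_bij[of "- J" "{card J..<CARD('n)}"] by auto
  define idx where "idx k = (if k \<in> J then f k else g k)" for k
  have "bij_betw idx J {..<card J}"
    using f by (subst bij_betw_cong[of _ _ f]) (auto simp: idx_def)
  moreover have "bij_betw idx (- J) {card J..<CARD('n)}"
    using g by (subst bij_betw_cong[of _ _ g]) (auto simp: idx_def)
  ultimately have "bij_betw idx (J \<union> - J) ({..<card J} \<union> {card J..<CARD('n)})"
    by (rule bij_betw_combine) auto
  then have "bij_betw idx UNIV {..<CARD('n)}"
    using le by (simp add: ivl_disj_un_one(2) Compl_partition)
  with \<open>bij_betw idx J {..<card J}\<close> show ?thesis
    using that by (auto simp: bij_betw_def)
qed

text \<open>Replacing the exceptional variable by its \<open>2 ^ r\<close>-th root turns the symbols into odd maps.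
  This is legitimate only where that variable is nonnegative, but oddness lets us choose the sign
  of the zero.\<close>

lemma ex_common_zero_of_weighted_forms:
  fixes l :: "nat ^ 'n" and b :: "nat \<Rightarrow> nat ^ 'n \<Rightarrow> complex"
  assumes pos: "\<And>k. 0 < l $ k"
    and N: "1 \<le> N"
    and J: "card J = 2 * N + 1" "k0 \<in> J" "\<And>k. k \<in> J - {k0} \<Longrightarrow> odd (l $ k)"
  obtains \<xi> :: "real ^ 'n" where "\<xi> \<noteq> 0"
    "\<And>j. j \<in> {1..N} \<Longrightarrow>
       (\<Sum>\<alpha> | wlen \<alpha> l = 1. b j \<alpha> * (\<Prod>k\<in>UNIV. complex_of_real (\<xi> $ k) ^ (\<alpha> $ k))) = 0"
proof -
  obtain r m where lk0: "l $ k0 = 2 ^ r * m" "odd m"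
    using multiplicity_decompose'[of "l $ k0" 2] pos[of k0] by (metis gr_implies_not0 odd_one)
  \<comment> \<open>The multi-indices whose monomials survive when the variables outside
    \<open>J\<close> are zero.\<close>
  define A where "A = {\<alpha>. wlen \<alpha> l = 1 \<and> (\<forall>k. k \<notin> J \<longrightarrow> \<alpha> $ k = 0)}"
  have finA: "finite A"
    by (rule finite_subset[OF _ finite_wlen_eq[OF pos]]) (auto simp: A_def)
  \<comment> \<open>Exponents in the new variable \<open>v $ k0\<close>, which stands for the
    \<open>2 ^ r\<close>-th power of the original one.\<close>
  define \<gamma> where "\<gamma> \<alpha> k = (if k = k0 then \<alpha> $ k div 2 ^ r else \<alpha> $ k)" for \<alpha> :: "nat ^ 'n" and k
  have \<gamma>: "2 ^ r dvd \<alpha> $ k0" "odd (\<Sum>k\<in>UNIV. \<gamma> \<alpha> k)" if "\<alpha> \<in> A" for \<alpha>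
  proof -
    have "(\<Sum>k\<in>J. real (\<alpha> $ k) / real (l $ k)) = wlen \<alpha> l"
      unfolding wlen_def using that by (intro sum.mono_neutral_left) (auto simp: A_def)
    then have one: "(\<Sum>k\<in>J. real (\<alpha> $ k) / real (l $ k)) = 1"
      using that by (simp add: A_def)
    note * = odd_sum_of_weighted_sum_eq_1_but_one[OF _ J(2,3) lk0 one]
    show "2 ^ r dvd \<alpha> $ k0"
      using *(1) by simp
    have "(\<Sum>k\<in>J. \<gamma> \<alpha> k) = (\<Sum>k\<in>UNIV. \<gamma> \<alpha> k)"
      using that J(2) by (intro sum.mono_neutral_left) (auto simp: A_def \<gamma>_def)
    then show "odd (\<Sum>k\<in>UNIV. \<gamma> \<alpha> k)"
      using *(2) by (simp add: \<gamma>_def)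
  qed
  define G where "G j v = (\<Sum>\<alpha>\<in>A. b j \<alpha> * (\<Prod>k\<in>UNIV. complex_of_real (v $ k) ^ \<gamma> \<alpha> k))"
    for j and v :: "real ^ 'n"
  have G_odd: "G j (- v) = - G j v" for j v
  proof -
    have "(\<Prod>k\<in>UNIV. complex_of_real ((- v) $ k) ^ \<gamma> \<alpha> k) =
        - (\<Prod>k\<in>UNIV. complex_of_real (v $ k) ^ \<gamma> \<alpha> k)" if "\<alpha> \<in> A" for \<alpha>
    proof -
      have "(\<Prod>k\<in>UNIV. complex_of_real ((- v) $ k) ^ \<gamma> \<alpha> k) =
          (\<Prod>k\<in>UNIV. (-1) ^ \<gamma> \<alpha> k * complex_of_real (v $ k) ^ \<gamma> \<alpha> k)"
        by (intro prod.cong refl) (simp flip: power_minus)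
      also have "\<dots> = (-1) ^ (\<Sum>k\<in>UNIV. \<gamma> \<alpha> k) * (\<Prod>k\<in>UNIV. complex_of_real (v $ k) ^ \<gamma> \<alpha> k)"
        by (simp add: prod.distrib power_sum)
      finally show ?thesis
        using \<gamma>(2)[OF that] by simp
    qed
    then show ?thesis
      unfolding G_def by (simp add: sum_negf[symmetric])
  qed
  have G_diff: "G j differentiable_on UNIV" for j
    unfolding G_def
    using finA differentiable_on_monomial
    by (auto simp: differentiable_on_def intro!: differentiable_sum differentiable_mult)
  \<comment> \<open>Real and imaginary parts of \<open>G 1\<close>, ..., \<open>G N\<close> at the
    indices 0 to \<open>2 * N - 1\<close>; the shift by 1 is due to the numbering of the symbols
    from 1.\<close>
  define p where "p i v = (if even i then Re (G (i div 2 + 1) v) else Im (G (i div 2 + 1) v))" for i v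
  obtain idx where idx: "bij_betw idx (UNIV :: 'n set) {..<CARD('n)}" "idx ` J = {..<card J}"
    by (rule ex_bij_betw_initial_segment)
  have le: "2 * N + 1 \<le> CARD('n)"
    using J(1) card_mono[of UNIV J] by simp
  \<comment> \<open>The sphere has dimension \<open>2 * N\<close> and uses the coordinates 0 to
    \<open>2 * N\<close>, which are exactly those of \<open>J\<close>.\<close>
  obtain x where x: "x \<in> topspace (nsphere (Suc (2 * N - 1)))"
    and px: "\<And>i. i \<le> 2 * N - 1 \<Longrightarrow> p i (vec_of_seq idx x) = 0"
  proof (rule Borsuk_Ulam_differentiable[OF idx(1), of "2 * N - 1" p])
    show "Suc (2 * N - 1) < CARD('n)"
      using le N by simp
    show "p i differentiable_on UNIV" for i
      using G_diff[of "i div 2 + 1"] bounded_linear_Re bounded_linear_Im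
      unfolding p_def differentiable_on_def
      by (cases "even i") (auto intro: differentiable_compose[OF bounded_linear_imp_differentiable])
    show "p i (- v) = - p i v" for i v
      by (simp add: p_def G_odd)
  qed auto
  define v :: "real ^ 'n" where "v = vec_of_seq idx x"
  have Gv: "G j v = 0" if "j \<in> {1..N}" for j
  proof (rule complex_eqI)
    show "Re (G j v) = Re 0"
      using px[of "2 * (j - 1)"] that by (auto simp: p_def v_def)
    show "Im (G j v) = Im 0"
      using px[of "2 * (j - 1) + 1"] that by (auto simp: p_def v_def)
  qed
  have "norm v = 1"
    unfolding v_def by (rule norm_vec_of_seq[OF idx(1) _ x]) (use le N in simp)
  then have "v \<noteq> 0" by auto
  have v0: "v $ k = 0" if "k \<notin> J" for k
  proof -
    have "idx k \<notin> idx ` J"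
      using idx(1) that by (auto simp: bij_betw_def dest: injD)
    then show ?thesis
      using x idx(2) J(1) N by (auto simp: v_def vec_of_seq_def nsphere)
  qed
  define w where "w = (if v $ k0 \<ge> 0 then v else - v)"
  have w: "w \<noteq> 0" "w $ k0 \<ge> 0" "\<And>k. k \<notin> J \<Longrightarrow> w $ k = 0" "\<And>j. j \<in> {1..N} \<Longrightarrow> G j w = 0"
    using \<open>v \<noteq> 0\<close> v0 Gv by (auto simp: w_def G_odd)
  define \<xi> :: "real ^ 'n" where "\<xi> = (\<chi> k. if k = k0 then root (2 ^ r) (w $ k) else w $ k)"
  show ?thesis
  proof (rule that[of \<xi>])
    obtain k where "w $ k \<noteq> 0"
      using w(1) by (auto simp: vec_eq_iff)
    then have "\<xi> $ k \<noteq> 0"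
      by (auto simp: \<xi>_def)
    then show "\<xi> \<noteq> 0" by auto
  next
    fix j assume j: "j \<in> {1..N}"
    have "(\<Sum>\<alpha> | wlen \<alpha> l = 1. b j \<alpha> * (\<Prod>k\<in>UNIV. complex_of_real (\<xi> $ k) ^ (\<alpha> $ k))) =
        (\<Sum>\<alpha>\<in>A. b j \<alpha> * (\<Prod>k\<in>UNIV. complex_of_real (\<xi> $ k) ^ (\<alpha> $ k)))"
    proof (rule sum.mono_neutral_right[OF finite_wlen_eq[OF pos]])
      show "\<forall>\<alpha>\<in>{\<alpha>. wlen \<alpha> l = 1} - A. b j \<alpha> * (\<Prod>k\<in>UNIV. complex_of_real (\<xi> $ k) ^ (\<alpha> $ k)) = 0"
      proof
        fix \<alpha> assume "\<alpha> \<in> {\<alpha>. wlen \<alpha> l = 1} - A"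
        then obtain k where "k \<notin> J" "\<alpha> $ k \<noteq> 0" by (auto simp: A_def)
        moreover from this have "\<xi> $ k = 0"
          using w(3) J(2) by (auto simp: \<xi>_def)
        ultimately have "(\<Prod>k\<in>UNIV. complex_of_real (\<xi> $ k) ^ (\<alpha> $ k)) = 0"
          by (intro prod_zero) (auto intro!: bexI[of _ k])
        then show "b j \<alpha> * (\<Prod>k\<in>UNIV. complex_of_real (\<xi> $ k) ^ (\<alpha> $ k)) = 0"
          by simp
      qed
    qed (auto simp: A_def)
    also have "\<dots> = G j w"
      unfolding G_def
    proof (intro sum.cong refl arg_cong2[where f = "(*)"] prod.cong)
      fix \<alpha> k assume "\<alpha> \<in> A"
      show "complex_of_real (\<xi> $ k) ^ (\<alpha> $ k) = complex_of_real (w $ k) ^ \<gamma> \<alpha> k"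
      proof (cases "k = k0")
        case True
        obtain q where q: "\<alpha> $ k0 = 2 ^ r * q"
          using \<gamma>(1)[OF \<open>\<alpha> \<in> A\<close>] by blast
        \<comment> \<open>The sign chosen for \<open>w\<close> enters here: an even power undoes the
          root only at nonnegative arguments.\<close>
        have "root (2 ^ r) (w $ k0) ^ (2 ^ r) = w $ k0"
          using w(2) by (intro real_root_pow_pos2) auto
        then have "complex_of_real (root (2 ^ r) (w $ k0)) ^ (2 ^ r) = complex_of_real (w $ k0)"
          by (metis of_real_power)
        then show ?thesis
          using True by (simp add: \<xi>_def \<gamma>_def q power_mult)
      qed (simp add: \<xi>_def \<gamma>_def)
    qed
    also have "\<dots> = 0"
      by (rule w(4)[OF j])
    finally show "(\<Sum>\<alpha> | wlen \<alpha> l = 1. b j \<alpha> * (\<Prod>k\<in>UNIV. complex_of_real (\<xi> $ k) ^ (\<alpha> $ k))) = 0" .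
  qed
qed

section \<open>Diagonal systems with constant coefficients\<close>

text \<open>Coefficients, constant in \<open>x\<close>, of the operator that sums \<open>w k\<close>
  times the \<open>l $ k\<close>-th power of \<open>D k\<close>. Writing them as a sum over
  \<open>k\<close> lets the symbol be computed by exchanging two sums.\<close>

definition diagonal_coeffs :: "nat ^ 'n \<Rightarrow> ('n \<Rightarrow> complex) \<Rightarrow> nat ^ 'n \<Rightarrow> real ^ 'n \<Rightarrow> complex" where
  "diagonal_coeffs l w \<alpha> x = (\<Sum>k\<in>UNIV. if \<alpha> = axis k (l $ k) then w k else 0)"

lemma principal_symbol_diagonal_coeffs:
  fixes l :: "nat ^ 'n"
  assumes pos: "\<And>k. 0 < l $ k"
  shows "principal_symbol l (diagonal_coeffs l w) x \<xi> =
    (\<Sum>k\<in>UNIV. w k * complex_of_real (\<xi> $ k) ^ (l $ k))"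
proof -
  have fin: "finite {\<alpha>. wlen \<alpha> l = 1}"
    by (rule finite_wlen_eq[OF pos])
  have wlen: "wlen (axis k (l $ k)) l = 1" for k
  proof -
    have "wlen (axis k (l $ k)) l = (\<Sum>i\<in>UNIV. if i = k then 1 else 0)"
      unfolding wlen_def using pos[of k] by (intro sum.cong) (auto simp: axis_def)
    then show ?thesis by simp
  qed
  have monom: "(\<Prod>i\<in>UNIV. complex_of_real (\<xi> $ i) ^ (axis k (l $ k) $ i)) =
      complex_of_real (\<xi> $ k) ^ (l $ k)" for k
  proof -
    have "(\<Prod>i\<in>UNIV. complex_of_real (\<xi> $ i) ^ (axis k (l $ k) $ i)) =
        (\<Prod>i\<in>UNIV. if i = k then complex_of_real (\<xi> $ k) ^ (l $ k) else 1)"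
      by (intro prod.cong) (auto simp: axis_def)
    then show ?thesis by simp
  qed
  have "principal_symbol l (diagonal_coeffs l w) x \<xi> =
      (\<Sum>\<alpha> | wlen \<alpha> l = 1. \<Sum>k\<in>UNIV. if \<alpha> = axis k (l $ k)
        then w k * (\<Prod>i\<in>UNIV. complex_of_real (\<xi> $ i) ^ (axis k (l $ k) $ i)) else 0)"
    unfolding principal_symbol_def diagonal_coeffs_def sum_distrib_right by (intro sum.cong) auto
  also have "\<dots> = (\<Sum>k\<in>UNIV. w k * complex_of_real (\<xi> $ k) ^ (l $ k))"
    by (subst sum.swap) (simp add: sum.delta'[OF fin] sum.delta[OF fin] wlen monom)
  finally show ?thesis .
qed

text \<open>There are \<open>2 * N\<close> real slots, the real and imaginary parts of
  \<open>N\<close> symbols. One slot is shared by all even powers, and each of the at most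
  \<open>2 * N - 1\<close> odd powers gets a slot of its own.\<close>

lemma ex_quasielliptic_diagonal_coeffs:
  fixes l :: "nat ^ 'n"
  assumes pos: "\<And>k. 0 < l $ k"
    and N: "1 \<le> N"
    and odd: "card {k. odd (l $ k)} \<le> 2 * N - 1"
  obtains w where "quasielliptic \<Omega> l N (\<lambda>j. diagonal_coeffs l (w j))"
proof -
  define Odd where "Odd = {k. odd (l $ k)}"
  obtain g where g: "bij_betw g Odd {..<card Odd}"
    using finite_same_card_bij[of Odd "{..<card Odd}"] by auto
  \<comment> \<open>The slot of the variable \<open>k\<close>; slot 0 is the one shared by the even
    weights.\<close>
  define f where "f k = (if k \<in> Odd then Suc (g k) else 0)" for k
  have f_less: "f k < 2 * N" for k
  proof (cases "k \<in> Odd")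
    case True
    then have "g k < card Odd"
      using g by (auto simp: bij_betw_def)
    then show ?thesis
      using True odd by (simp add: f_def Odd_def)
  qed (use N in \<open>simp add: f_def\<close>)
  \<comment> \<open>The slots \<open>2 * (j - 1)\<close> and \<open>2 * (j - 1) + 1\<close> are the
    real and imaginary parts of the symbol \<open>j\<close>.\<close>
  define w where "w j k = (if f k = 2 * (j - 1) then 1 else if f k = 2 * (j - 1) + 1 then \<i> else 0)"
    for j k
  show ?thesis
  proof (rule that[of w], unfold quasielliptic_def, intro ballI allI impI, rule ccontr)
    fix x and \<xi> :: "real ^ 'n"
    assume "\<xi> \<noteq> 0" and no: "\<not> (\<exists>j\<in>{1..N}. principal_symbol l (diagonal_coeffs l (w j)) x \<xi> \<noteq> 0)"
    \<comment> \<open>The real form in slot \<open>t\<close>, recovered below as a real or imaginary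
      part of a vanishing symbol.\<close>
    define S where "S t = (\<Sum>k | f k = t. (\<xi> $ k) ^ (l $ k))" for t
    have S0: "S t = 0" if t: "t < 2 * N" for t
    proof -
      define j where "j = t div 2 + 1"
      have "j \<in> {1..N}" using t by (auto simp: j_def)
      with no have zero: "(\<Sum>k\<in>UNIV. w j k * complex_of_real (\<xi> $ k) ^ (l $ k)) = 0"
        by (auto simp: principal_symbol_diagonal_coeffs[OF pos])
      have S_eq: "S t = (\<Sum>k\<in>UNIV. if f k = t then (\<xi> $ k) ^ (l $ k) else 0)"
        by (simp add: S_def sum.If_cases)
      show ?thesis
      proof (cases "even t")
        case True
        have "S t = (\<Sum>k\<in>UNIV. Re (w j k * complex_of_real (\<xi> $ k) ^ (l $ k)))"
          unfolding S_eq using True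
          by (intro sum.cong) (auto simp: w_def j_def simp flip: of_real_power)
        then show ?thesis
          using arg_cong[OF zero, of Re] by simp
      next
        case False
        have "S t = (\<Sum>k\<in>UNIV. Im (w j k * complex_of_real (\<xi> $ k) ^ (l $ k)))"
          unfolding S_eq using False
          by (intro sum.cong) (auto simp: w_def j_def simp flip: of_real_power elim!: oddE)
        then show ?thesis
          using arg_cong[OF zero, of Im] by simp
      qed
    qed
    have "\<xi> $ k = 0" for k
    proof (cases "k \<in> Odd")
      case True
      then have "{k'. f k' = f k} = {k}"
        using g by (auto simp: f_def bij_betw_def dest: inj_onD)
      then show ?thesis
        using S0[OF f_less[of k]] by (simp add: S_def)
    next
      case False
      have "{k'. f k' = 0} = - Odd"
        by (auto simp: f_def)
      then have "(\<Sum>k\<in>- Odd. (\<xi> $ k) ^ (l $ k)) = 0"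
        using S0[of 0] N by (simp add: S_def)
      \<comment> \<open>Even powers are nonnegative, so each term of their vanishing sum is
        zero.\<close>
      then have "\<forall>k\<in>- Odd. (\<xi> $ k) ^ (l $ k) = 0"
        by (subst (asm) sum_nonneg_eq_0_iff) (auto simp: Odd_def zero_le_even_power)
      then show ?thesis
        using False by auto
    qed
    with \<open>\<xi> \<noteq> 0\<close> show False
      by (simp add: vec_eq_iff)
  qed
qed

theorem theorem1p2:
  fixes \<Omega> :: "(real ^ 'n) set" and l :: "nat ^ 'n" and N :: nat
  assumes "domain \<Omega>"
    and "\<And>k. 0 < l $ k"
    and "1 \<le> N"
    and "2 * N + 1 \<le> CARD('n)"
  shows "(\<exists>(P :: nat \<Rightarrow> (real ^ 'n \<Rightarrow> complex) \<Rightarrow> real ^ 'n \<Rightarrow> complex)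
            (a :: nat \<Rightarrow> nat ^ 'n \<Rightarrow> real ^ 'n \<Rightarrow> complex).
            (\<forall>j\<in>{1..N}. diff_operator_on \<Omega> l (a j) (P j)) \<and>
            (\<forall>j\<in>{1..N}. \<forall>\<alpha>. wlen \<alpha> l \<le> 1 \<longrightarrow>
               a j \<alpha> \<in> borel_measurable (lebesgue_on \<Omega>)) \<and>
            quasielliptic \<Omega> l N a)
         \<longleftrightarrow> card {k. odd (l $ k)} \<le> 2 * N - 1"
proof
  assume "\<exists>(P :: nat \<Rightarrow> (real ^ 'n \<Rightarrow> complex) \<Rightarrow> real ^ 'n \<Rightarrow> complex)
            (a :: nat \<Rightarrow> nat ^ 'n \<Rightarrow> real ^ 'n \<Rightarrow> complex).
            (\<forall>j\<in>{1..N}. diff_operator_on \<Omega> l (a j) (P j)) \<and>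
            (\<forall>j\<in>{1..N}. \<forall>\<alpha>. wlen \<alpha> l \<le> 1 \<longrightarrow>
               a j \<alpha> \<in> borel_measurable (lebesgue_on \<Omega>)) \<and>
            quasielliptic \<Omega> l N a"
  then obtain a where a: "quasielliptic \<Omega> l N a" by blast
  show "card {k. odd (l $ k)} \<le> 2 * N - 1"
  proof (rule ccontr)
    assume "\<not> ?thesis"
    then have "2 * N \<le> card {k. odd (l $ k)}"
      by simp
    then obtain I where I: "I \<subseteq> {k. odd (l $ k)}" "card I = 2 * N"
      by (meson obtain_subset_with_card_n)
    then have "I \<noteq> UNIV"
      using assms(4) by auto
    \<comment> \<open>The further variable, whose weight may be even or odd.\<close>
    then obtain k0 where k0: "k0 \<notin> I" by auto
    obtain x where x: "x \<in> \<Omega>"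
      using assms(1) by (auto simp: domain_def)
    obtain \<xi> :: "real ^ 'n" where "\<xi> \<noteq> 0"
      "\<And>j. j \<in> {1..N} \<Longrightarrow>
        (\<Sum>\<alpha> | wlen \<alpha> l = 1. a j \<alpha> x * (\<Prod>k\<in>UNIV. complex_of_real (\<xi> $ k) ^ (\<alpha> $ k))) = 0"
    proof (rule ex_common_zero_of_weighted_forms[of l N "insert k0 I" k0 "\<lambda>j \<alpha>. a j \<alpha> x"])
      show "card (insert k0 I) = 2 * N + 1"
        using k0 I(2) by simp
      show "odd (l $ k)" if "k \<in> insert k0 I - {k0}" for k
        using that I(1) by auto
    qed (use assms in auto)
    moreover from a x \<open>\<xi> \<noteq> 0\<close> obtain j where "j \<in> {1..N}" "principal_symbol l (a j) x \<xi> \<noteq> 0"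
      unfolding quasielliptic_def by blast
    ultimately show False
      by (simp add: principal_symbol_def)
  qed
next
  assume "card {k. odd (l $ k)} \<le> 2 * N - 1"
  then obtain w where w: "quasielliptic \<Omega> l N (\<lambda>j. diagonal_coeffs l (w j))"
    using ex_quasielliptic_diagonal_coeffs[OF assms(2,3)] by blast
  define P where "P j u x = (\<Sum>\<alpha> | wlen \<alpha> l \<le> 1. diagonal_coeffs l (w j) \<alpha> x * D_multi \<alpha> u x)"
    for j u and x :: "real ^ 'n"
  have "diagonal_coeffs l (w j) \<alpha> \<in> borel_measurable (lebesgue_on \<Omega>)" for j \<alpha>
    by (simp add: diagonal_coeffs_def[abs_def])
  then show "\<exists>(P :: nat \<Rightarrow> (real ^ 'n \<Rightarrow> complex) \<Rightarrow> real ^ 'n \<Rightarrow> complex)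
            (a :: nat \<Rightarrow> nat ^ 'n \<Rightarrow> real ^ 'n \<Rightarrow> complex).
            (\<forall>j\<in>{1..N}. diff_operator_on \<Omega> l (a j) (P j)) \<and>
            (\<forall>j\<in>{1..N}. \<forall>\<alpha>. wlen \<alpha> l \<le> 1 \<longrightarrow>
               a j \<alpha> \<in> borel_measurable (lebesgue_on \<Omega>)) \<and>
            quasielliptic \<Omega> l N a"
    using w by (intro exI[of _ P] exI[of _ "\<lambda>j. diagonal_coeffs l (w j)"])
      (auto simp: diff_operator_on_def P_def)
qed

end
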